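(* Let $G=(V,E)$ be a countable graph of finite degree, let $p=(p_e)_{e\in E}$ with $p_e\in[0,1]$, let $q\ge1$, and fix an enumeration $E=\{e_1,e_2,\dots\}$. For $e\in E$ let $$g_e=2\,p_e+3\sum_{e'\in\Gamma(\{e\})}p_{e'}.$$ If $p_e<1$ for all $e\in E$ and $$\lim_{\Lambda\uparrow E}\ \sup_{e\notin\Lambda}g_e<1$$ (limit along finite subsets $\Lambda$ of $E$ increasing to $E$), then for all $e\in E$ the set $C^b_e(u)$ is finite for almost all $u\in\mathcal{U}$.
   Context: **Graphs.** A graph $(V,E)$ consists of a set $V$ of vertexes, a set $E$ of edges, and a map from $E$ to unordered pairs of distinct vertexes (the end vertexes of the edge). Finite degree: each vertex is an end vertex of finitely many edges. For $H\subset E$, $\Gamma(H)$ is the set of edges not in $H$ that have a vertex in common with an edge in $H$. The graph $\bar G$ has vertex set $\mathbb{Z}_{<0}\times V$ and edge set $\bar E=\mathbb{Z}_{<0}\times E$; if $e\in E$ has end vertexes $x,y$ then $(n,e)$ has end vertexes $(n,x),(n,y)$. A subset $F$ of $E$ is identified with $\{-1\}\times F\subset\bar E$. **Coloring and clusters.** Let $\hat p_e=p_e/(p_e+q(1-p_e))$. Let $\mathcal{A}=\{(n,k)\in\mathbb{Z}^2:n\le-1,\ k\ge1\}$ and $\mathcal{U}=[0,1]^{\mathcal{A}}$ with the Lebesgue product measure (so the coordinates $u_{n,k}$ are i.i.d. uniform on $[0,1]$). For $u\in\mathcal{U}$: $W(u)=\{(n,e_k):(n,k)\in\mathcal{A},\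 p_{e_k}\le u_{n,k}\le1\}$ (white), $M(u)=\{(n,e_k):(n,k)\in\mathcal{A},\ \hat p_{e_k}\le u_{n,k}<p_{e_k}\}$ (gray); the remaining edges of $\bar E$ are black. For $F\subset M(u)$, the cluster of black or gray edges $C_F^b=C_F^b(u)$ is the smallest subset $C$ of $\bar E$ containing $F$ such that for all $(n,e)\in\bar E\setminus C$, if $(n-1,e)$ or $(n,e)$ or $(n+1,e)$ has a vertex in common with an edge in $C$, then $(n,e)\in W(u)$. If $F\subset\bar E$ is not necessarily contained in $M(u)$, $C_F^b(u)=C^b_{F\cap M(u)}(u)\cup F$. $C^b_e(u)$ denotes $C^b_{\{e\}}(u)$, i.e. the cluster of $\{(-1,e)\}$. *)

theory Defs
  imports "HOL-Probability.Probability"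
begin

record ('v, 'e) mgraph =
  verts :: "'v set"
  edges :: "'e set"
  ends :: "'e \<Rightarrow> 'v set"

text \<open>Multiple edges are allowed, loops are not: unordered pairs of distinct vertexes
  are two-element sets.\<close>

definition mgraph :: "('v, 'e) mgraph \<Rightarrow> bool" where
  "mgraph G \<longleftrightarrow> (\<forall>e\<in>edges G. ends G e \<subseteq> verts G \<and> card (ends G e) = 2)"

definition countable_graph :: "('v, 'e) mgraph \<Rightarrow> bool" where
  "countable_graph G \<longleftrightarrow> mgraph G \<and> countable (verts G) \<and> countable (edges G)"

definition finite_degree :: "('v, 'e) mgraph \<Rightarrow> bool" where
  "finite_degree G \<longleftrightarrow> (\<forall>x\<in>verts G. finite {e \<in> edges G. x \<in> ends G e})"

definition meets :: "('v, 'e) mgraph \<Rightarrow> 'e \<Rightarrow> 'e set \<Rightarrow> bool" where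
  "meets G e H \<longleftrightarrow> (\<exists>f\<in>H. ends G e \<inter> ends G f \<noteq> {})"

definition \<Gamma> :: "('v, 'e) mgraph \<Rightarrow> 'e set \<Rightarrow> 'e set" where
  "\<Gamma> G H = {e \<in> edges G - H. meets G e H}"

definition bar :: "('v, 'e) mgraph \<Rightarrow> (int \<times> 'v, int \<times> 'e) mgraph" where
  "bar G = \<lparr> verts = {..<0} \<times> verts G, edges = {..<0} \<times> edges G,
             ends = (\<lambda>(n, e). Pair n ` ends G e) \<rparr>"

lemma mgraph_bar:
  assumes "mgraph G"
  shows "mgraph (bar G)"
  using assms by (auto simp: mgraph_def bar_def card_image inj_on_def)

text \<open>An enumeration \<open>e\<^sub>1, e\<^sub>2, \<dots>\<close> without repetitions; it stops at \<open>card E\<close> if the set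
  \<open>E\<close> is finite.\<close>

definition indices :: "'e set \<Rightarrow> nat set" where
  "indices E = {k. 1 \<le> k \<and> (finite E \<longrightarrow> k \<le> card E)}"

definition enumeration :: "(nat \<Rightarrow> 'e) \<Rightarrow> 'e set \<Rightarrow> bool" where
  "enumeration en E \<longleftrightarrow> bij_betw en (indices E) E"

definition p_hat :: "('e \<Rightarrow> real) \<Rightarrow> real \<Rightarrow> 'e \<Rightarrow> real" where
  "p_hat p q e = p e / (p e + q * (1 - p e))"

definition \<A> :: "(int \<times> nat) set" where
  "\<A> = {(n, k). n \<le> -1 \<and> k \<ge> 1}"

definition \<U> :: "(int \<times> nat \<Rightarrow> real) measure" where
  "\<U> = PiM \<A> (\<lambda>_. restrict_space lborel {0..1})"

definition white ::
  "('v, 'e) mgraph \<Rightarrow> (nat \<Rightarrow> 'e) \<Rightarrow> ('e \<Rightarrow> real) \<Rightarrow> (int \<times> nat \<Rightarrow> real) \<Rightarrow> (int \<times> 'e) set" where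
  "white G en p u = {(n, en k) | n k. (n, k) \<in> \<A> \<and> k \<in> indices (edges G) \<and>
     p (en k) \<le> u (n, k) \<and> u (n, k) \<le> 1}"

definition gray ::
  "('v, 'e) mgraph \<Rightarrow> (nat \<Rightarrow> 'e) \<Rightarrow> ('e \<Rightarrow> real) \<Rightarrow> real \<Rightarrow> (int \<times> nat \<Rightarrow> real) \<Rightarrow> (int \<times> 'e) set" where
  "gray G en p q u = {(n, en k) | n k. (n, k) \<in> \<A> \<and> k \<in> indices (edges G) \<and>
     p_hat p q (en k) \<le> u (n, k) \<and> u (n, k) < p (en k)}"

text \<open>For \<open>n = -1\<close> the pair \<open>(n + 1, e)\<close> is not an edge of \<open>bar G\<close>. The function \<open>ends\<close> gives it
  end vertexes at level \<open>0\<close>, which lie on no edge of a subset of \<open>edges (bar G)\<close>, so the third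
  alternative is then false.\<close>

definition white_boundary ::
  "('v, 'e) mgraph \<Rightarrow> (nat \<Rightarrow> 'e) \<Rightarrow> ('e \<Rightarrow> real) \<Rightarrow> (int \<times> nat \<Rightarrow> real) \<Rightarrow> (int \<times> 'e) set \<Rightarrow> bool" where
  "white_boundary G en p u C \<longleftrightarrow>
     (\<forall>(n, e) \<in> edges (bar G) - C.
        meets (bar G) (n - 1, e) C \<or> meets (bar G) (n, e) C \<or> meets (bar G) (n + 1, e) C
        \<longrightarrow> (n, e) \<in> white G en p u)"

definition gray_cluster ::
  "('v, 'e) mgraph \<Rightarrow> (nat \<Rightarrow> 'e) \<Rightarrow> ('e \<Rightarrow> real) \<Rightarrow> (int \<times> nat \<Rightarrow> real) \<Rightarrow>
     (int \<times> 'e) set \<Rightarrow> (int \<times> 'e) set" where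
  "gray_cluster G en p u F = \<Inter>{C. C \<subseteq> edges (bar G) \<and> F \<subseteq> C \<and> white_boundary G en p u C}"

text \<open>The intersection belongs to the family, hence is its smallest member.\<close>

lemma gray_cluster_least:
  assumes "F \<subseteq> edges (bar G)"
  shows "gray_cluster G en p u F \<subseteq> edges (bar G)"
    and "F \<subseteq> gray_cluster G en p u F"
    and "white_boundary G en p u (gray_cluster G en p u F)"
    and "\<lbrakk>C \<subseteq> edges (bar G); F \<subseteq> C; white_boundary G en p u C\<rbrakk>
      \<Longrightarrow> gray_cluster G en p u F \<subseteq> C"
proof -
  have "white_boundary G en p u (edges (bar G))"
    by (auto simp: white_boundary_def)
  then show "gray_cluster G en p u F \<subseteq> edges (bar G)"
    unfolding gray_cluster_def using assms by blast
  show "F \<subseteq> gray_cluster G en p u F"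
    unfolding gray_cluster_def by blast
  show least: "gray_cluster G en p u F \<subseteq> C"
    if "C \<subseteq> edges (bar G)" "F \<subseteq> C" "white_boundary G en p u C" for C
    unfolding gray_cluster_def using that by blast
  have mono: "meets (bar G) x C" if "meets (bar G) x B" "B \<subseteq> C" for x B C
    using that by (auto simp: meets_def)
  show "white_boundary G en p u (gray_cluster G en p u F)"
    unfolding white_boundary_def
  proof clarify
    fix n e
    assume e: "(n, e) \<in> edges (bar G)" "(n, e) \<notin> gray_cluster G en p u F"
      and m: "meets (bar G) (n - 1, e) (gray_cluster G en p u F) \<or>
        meets (bar G) (n, e) (gray_cluster G en p u F) \<or>
        meets (bar G) (n + 1, e) (gray_cluster G en p u F)"
    from e(2) obtain C where C: "C \<subseteq> edges (bar G)" "F \<subseteq> C" "white_boundary G en p u C"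
        "(n, e) \<notin> C"
      unfolding gray_cluster_def by blast
    then have "meets (bar G) (n - 1, e) C \<or> meets (bar G) (n, e) C \<or> meets (bar G) (n + 1, e) C"
      using m mono least by meson
    then show "(n, e) \<in> white G en p u"
      using C e(1) unfolding white_boundary_def by blast
  qed
qed

definition cluster ::
  "('v, 'e) mgraph \<Rightarrow> (nat \<Rightarrow> 'e) \<Rightarrow> ('e \<Rightarrow> real) \<Rightarrow> real \<Rightarrow> (int \<times> nat \<Rightarrow> real) \<Rightarrow>
     (int \<times> 'e) set \<Rightarrow> (int \<times> 'e) set" where
  "cluster G en p q u F = gray_cluster G en p u (F \<inter> gray G en p q u) \<union> F"

definition g :: "('v, 'e) mgraph \<Rightarrow> ('e \<Rightarrow> real) \<Rightarrow> 'e \<Rightarrow> real" where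
  "g G p e = 2 * p e + 3 * (\<Sum>e'\<in>\<Gamma> G {e}. p e')"

end

theory Submission
  imports Defs
begin

text \<open>
Call an edge of \<open>bar G\<close> open if it is black or gray, so that the edges \<open>(n, e)\<close> are open
independently with probability \<open>p e\<close>. The cluster of \<open>(-1, e)\<close> is contained in every set that
contains \<open>(-1, e)\<close> and all open neighbours of its elements, and it suffices to find a finite set of this
kind almost surely. The number \<open>g G p e\<close> bounds the expected number of open neighbours of \<open>(n, e)\<close>.

By hypothesis there are a finite set \<open>\<Lambda>\<close> of edges and a constant \<open>r < 1\<close> with \<open>g \<le> r\<close> off \<open>\<Lambda>\<close>. Outside
the columns over \<open>\<Lambda>\<close> the percolation is therefore subcritical: an open self-avoiding walk of length
\<open>k\<close> from a given edge exists with probability at most \<open>r ^ k\<close> (\<open>prob_reach_le\<close>). The columns over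
\<open>\<Lambda>\<close> are infinite and may be supercritical in combination with their surroundings, but they form a
one-dimensional structure, and \<open>p < 1\<close> makes it possible to cut it.

The cut at depth \<open>d\<close> (\<open>barrier\<close>) requires that the last \<open>K\<close> levels down to \<open>d\<close> are closed over \<open>\<Lambda>\<close>
and over the edges next to \<open>\<Lambda>\<close>, and that no excursion away from \<open>\<Lambda>\<close> that starts above these levels
reaches depth \<open>d\<close>. An excursion that starts \<open>k\<close> levels above \<open>d\<close> has probability at most \<open>r ^ k\<close> to do
so. Summed over \<open>k \<ge> K\<close>, this is small for large \<open>K\<close>, so a cut has a probability that is bounded below
independently of \<open>d\<close> (\<open>prob_barrier_ge\<close>).

To conclude that some cut occurs, take \<open>d = 4 ^ (j + 1)\<close>. The excursions that start within distance
\<open>4 ^ j\<close> of the depth \<open>d\<close> are followed for so few steps that the events for different \<open>j\<close> use disjoint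
sets of edges; they are independent, hence infinitely many of them occur (\<open>indep_barriers\<close>,
\<open>AE_infinitely_often\<close>). The excursions over a longer distance occur for finitely many \<open>j\<close> only, by the
first Borel-Cantelli lemma (\<open>AE_eventually_no_far_crossing\<close>). For a \<open>j\<close> with a barrier and without long
excursions, the columns above depth \<open>d\<close> and the components of the excursions from them form the
finite set in question (\<open>finite_closed_set\<close>, \<open>barrier_finite_closed_set\<close>).
\<close>

section \<open>Walks and open components\<close>

primrec walks :: "('x \<Rightarrow> 'x set) \<Rightarrow> 'x set \<Rightarrow> nat \<Rightarrow> 'x \<Rightarrow> 'x list set" where
  "walks N S 0 x = {[x]}"
| "walks N S (Suc k) x = (\<Union>y\<in>N x \<inter> S. (#) x ` walks N S k y)"

text \<open>A set \<open>A\<close> stands for the open sites throughout. The walk is required to be self-avoiding so that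
its sites are independent; \<open>component_walk\<close> shows that this loses no connections.\<close>

definition reach :: "('x \<Rightarrow> 'x set) \<Rightarrow> 'x set \<Rightarrow> 'x set \<Rightarrow> nat \<Rightarrow> 'x \<Rightarrow> bool" where
  "reach N S A k x \<longleftrightarrow> (\<exists>xs\<in>walks N S k x. distinct xs \<and> set xs \<subseteq> A)"

definition component :: "('x \<Rightarrow> 'x set) \<Rightarrow> 'x set \<Rightarrow> 'x set \<Rightarrow> 'x \<Rightarrow> 'x set" where
  "component N S A x = {z. (x, z) \<in> {(a, b). b \<in> N a \<inter> S \<inter> A}\<^sup>*}"

lemma walks_nonempty: "xs \<in> walks N S k x \<Longrightarrow> xs \<noteq> [] \<and> hd xs = x"
  by (cases k) auto

lemma walks_subset: "xs \<in> walks N S k x \<Longrightarrow> set xs \<subseteq> insert x S"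
  by (induction k arbitrary: x xs) (auto, blast)

lemma finite_walks:
  assumes "\<And>x. finite (N x)"
  shows "finite (walks N S k x)"
  using assms by (induction k arbitrary: x) auto

text \<open>Loop erasure: a self-avoiding walk that runs into \<open>y\<close> can be started at \<open>y\<close> instead. This is
what allows a walk to be extended at its front and stay self-avoiding.\<close>

lemma walks_suffix:
  assumes "xs \<in> walks N S k x" "y \<in> set xs" "distinct xs"
  shows "\<exists>j. \<exists>ys\<in>walks N S j y. distinct ys \<and> set ys \<subseteq> set xs \<and> last ys = last xs"
  using assms
proof (induction k arbitrary: x xs)
  case 0
  then show ?case by (auto intro!: exI[of _ 0])
next
  case (Suc k)
  then obtain w ys where w: "w \<in> N x \<inter> S" "ys \<in> walks N S k w" "xs = x # ys"
    by auto
  have ne: "ys \<noteq> []" using walks_nonempty w by fast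
  show ?case
  proof (cases "y = x")
    case True
    with Suc.prems show ?thesis by (intro exI[of _ "Suc k"] bexI[of _ xs]) auto
  next
    case False
    then have "\<exists>j. \<exists>zs\<in>walks N S j y. distinct zs \<and> set zs \<subseteq> set ys \<and> last zs = last ys"
      using Suc.prems w by (intro Suc.IH) auto
    then show ?thesis using w ne by auto
  qed
qed

lemma walks_take:
  assumes "xs \<in> walks N S k x" "j \<le> k"
  shows "take (Suc j) xs \<in> walks N S j x"
  using assms
proof (induction k arbitrary: x xs j)
  case (Suc k)
  then show ?case by (cases j) (auto, blast)
qed auto

lemma reach_mono:
  assumes "reach N S A k x" "j \<le> k"
  shows "reach N S A j x"
proof -
  from assms obtain xs where xs: "xs \<in> walks N S k x" "distinct xs" "set xs \<subseteq> A"
    unfolding reach_def by auto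
  then show ?thesis
    unfolding reach_def using walks_take[OF xs(1) assms(2)] set_take_subset[of "Suc j" xs]
    by (intro bexI[of _ "take (Suc j) xs"]) auto
qed

lemma walks_restrict:
  assumes "xs \<in> walks N S k x" "set xs \<subseteq> A" "A \<inter> T = {}"
  shows "xs \<in> walks N (S - T) k x"
  using assms
proof (induction k arbitrary: x xs)
  case (Suc k)
  then obtain w ys where w: "w \<in> N x \<inter> S" "ys \<in> walks N S k w" "xs = x # ys"
    by auto
  then have "hd ys = w" "ys \<noteq> []" using walks_nonempty by fast+
  then have "w \<in> A" using Suc.prems w by (cases ys) auto
  then have "w \<in> S - T" using w Suc.prems by auto
  moreover have "ys \<in> walks N (S - T) k w" using Suc w by auto
  ultimately show ?case using w by auto
qed auto

text \<open>An open walk avoids every closed site by itself. Hence a bound on walks that are forbidden to use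
a set \<open>T\<close> also applies to all open walks once \<open>T\<close> is closed, although the forbidden walks do not
depend on the state of \<open>T\<close>.\<close>

lemma reach_restrict:
  assumes "reach N S A k x" "A \<inter> T = {}"
  shows "reach N (S - T) A k x"
proof -
  from assms(1) obtain xs where "xs \<in> walks N S k x" "distinct xs" "set xs \<subseteq> A"
    unfolding reach_def by auto
  then show ?thesis using walks_restrict[OF _ _ assms(2)] unfolding reach_def by blast
qed

lemma component_walk:
  assumes "z \<in> component N S A x" "x \<in> A"
  shows "\<exists>k. \<exists>xs\<in>walks N S k x. distinct xs \<and> set xs \<subseteq> A \<and> last xs = z"
proof -
  have "(x, z) \<in> {(a, b). b \<in> N a \<inter> S \<inter> A}\<^sup>*" using assms by (simp add: component_def)
  then show ?thesis using assms(2)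
  proof (induction rule: converse_rtrancl_induct)
    case base
    then show ?case by (intro exI[of _ 0]) auto
  next
    case (step y w)
    then obtain k ys where ys: "ys \<in> walks N S k w" "distinct ys" "set ys \<subseteq> A" "last ys = z"
      by auto
    show ?case
    proof (cases "y \<in> set ys")
      case True
      from walks_suffix[OF ys(1) True ys(2)] ys show ?thesis by fastforce
    next
      case False
      have "y # ys \<in> walks N S (Suc k) y" using ys step by auto
      moreover have "ys \<noteq> []" using walks_nonempty ys by fast
      ultimately show ?thesis
        using False ys step by (intro exI[of _ "Suc k"] bexI[of _ "y # ys"]) auto
    qed
  qed
qed

lemma height_walks:
  fixes h :: "'x \<Rightarrow> nat"
  assumes "\<And>x y. y \<in> N x \<Longrightarrow> h y \<le> h x + 1 \<and> h x \<le> h y + 1"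
    and "xs \<in> walks N S k x" "z \<in> set xs"
  shows "h z \<le> h x + k \<and> h x \<le> h z + k"
  using assms(2,3)
proof (induction k arbitrary: x xs)
  case (Suc k)
  then obtain w ys where w: "w \<in> N x" "ys \<in> walks N S k w" "xs = x # ys"
    by auto
  show ?case
  proof (cases "z = x")
    case False
    then have "h z \<le> h w + k \<and> h w \<le> h z + k" using Suc w by auto
    then show ?thesis using assms(1)[OF w(1)] by auto
  qed auto
qed auto

text \<open>If no open self-avoiding walk of length \<open>k\<close> leaves \<open>x\<close>, then every site of the component is the
end of a shorter one: there are finitely many of these, and each gains less than \<open>k\<close> in height.\<close>

lemma not_reach_component:
  assumes fin: "\<And>x. finite (N x)"
    and h: "\<And>x y. y \<in> N x \<Longrightarrow> h y \<le> h x + 1 \<and> h x \<le> h y + (1::nat)"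
    and nr: "\<not> reach N S A k x" and x: "x \<in> A"
  shows "finite (component N S A x)" and "z \<in> component N S A x \<Longrightarrow> h z < h x + k"
proof -
  have *: "\<exists>j<k. \<exists>xs\<in>walks N S j x. z \<in> set xs" if "z \<in> component N S A x" for z
  proof -
    from component_walk[OF that x] obtain j xs
      where xs: "xs \<in> walks N S j x" "distinct xs" "set xs \<subseteq> A" "last xs = z" by auto
    then have "reach N S A j x" unfolding reach_def by auto
    then have "j < k" using nr reach_mono by (metis not_less)
    moreover have "z \<in> set xs" using xs walks_nonempty by fastforce
    ultimately show ?thesis using xs by auto
  qed
  then have "component N S A x \<subseteq> (\<Union>j<k. \<Union>xs\<in>walks N S j x. set xs)" by fastforce
  then show "finite (component N S A x)"
    by (rule finite_subset) (auto simp: finite_walks fin)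
  show "h z < h x + k" if "z \<in> component N S A x"
    using *[OF that] height_walks[of N h, OF h] by fastforce
qed

text \<open>The sites are split into a core \<open>B\<close> and a surrounding part \<open>S\<close>. If the core is closed at height
\<open>d\<close>, then a connection from the core below \<open>d\<close> to the core above \<open>d\<close> must make an excursion
through \<open>S\<close> that reaches height \<open>d\<close>. The hypothesis \<open>esc\<close> forbids such excursions, and it also makes all
components met by the excursions finite. So the core below \<open>d\<close> together with the components in
\<open>S\<close> of its open neighbours is a finite set that contains all open neighbours of its elements.\<close>

lemma finite_closed_set:
  fixes h :: "'x \<Rightarrow> nat"
  assumes fin: "\<And>x. finite (N x)"
    and h: "\<And>x y. y \<in> N x \<Longrightarrow> h y \<le> h x + 1 \<and> h x \<le> h y + 1"
    and N: "\<And>x. N x \<subseteq> S \<union> B"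
    and B: "finite {x\<in>B. h x < d}"
    and bar: "\<And>x. x \<in> B \<Longrightarrow> h x = d \<Longrightarrow> x \<notin> A"
    and esc: "\<And>b y. \<lbrakk>b \<in> B; h b < d; y \<in> N b; y \<in> S; y \<in> A\<rbrakk> \<Longrightarrow> 
      \<exists>k. h y + k \<le> d \<and> \<not> reach N S A k y"
  shows "\<exists>Q. finite Q \<and> Q \<subseteq> S \<union> B \<and> {x\<in>B. h x < d} \<subseteq> Q \<and> (\<forall>x\<in>Q. \<forall>z\<in>N x \<inter> A. z \<in> Q)"
proof -
  define B0 where "B0 = {x\<in>B. h x < d}"
  define Y where "Y = (\<Union>b\<in>B0. N b \<inter> S \<inter> A)"
  define Q where "Q = B0 \<union> (\<Union>y\<in>Y. component N S A y)"
  have comp: "finite (component N S A y) \<and> (\<forall>z\<in>component N S A y. h z < d)" if "y \<in> Y" for y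
  proof -
    from that obtain b where "b \<in> B" "h b < d" "y \<in> N b" "y \<in> S" and y: "y \<in> A"
      by (auto simp: Y_def B0_def)
    from esc[OF this] obtain k where k: "h y + k \<le> d" "\<not> reach N S A k y" by auto
    show ?thesis
      using not_reach_component[of N h S A k y, OF fin h k(2) y] k(1) by fastforce
  qed
  have "finite Y" using B fin by (auto simp: Y_def B0_def)
  then have "finite Q" using comp B by (auto simp: Q_def B0_def)
  moreover have "component N S A y \<subseteq> S" if "y \<in> Y" for y
  proof
    fix z assume "z \<in> component N S A y"
    then have "(y, z) \<in> {(a, b). b \<in> N a \<inter> S \<inter> A}\<^sup>*" by (simp add: component_def)
    then show "z \<in> S" by (cases rule: rtranclE) (use that in \<open>auto simp: Y_def\<close>)
  qed
  then have "Q \<subseteq> S \<union> B" by (auto simp: Q_def B0_def)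
  moreover have "z \<in> Q" if x: "x \<in> Q" and z: "z \<in> N x" "z \<in> A" for x z
  proof -
    have hx: "h x < d" using x comp by (auto simp: Q_def B0_def)
    then have hz: "h z \<le> d" using h[OF z(1)] by simp
    show ?thesis
    proof (cases "z \<in> B")
      case True
      then have "h z \<noteq> d" using bar z by auto
      then show ?thesis using True hz by (auto simp: Q_def B0_def)
    next
      case False
      then have "z \<in> S" using N z by auto
      show ?thesis
      proof (cases "x \<in> B0")
        case True
        then have "z \<in> Y" using z \<open>z \<in> S\<close> by (auto simp: Y_def)
        then show ?thesis by (auto simp: Q_def component_def)
      next
        case False
        then obtain y where y: "y \<in> Y" "x \<in> component N S A y" using x by (auto simp: Q_def)
        then have "z \<in> component N S A y"
          using z \<open>z \<in> S\<close> by (auto simp: component_def intro: rtrancl_into_rtrancl)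
        then show ?thesis using y by (auto simp: Q_def)
      qed
    qed
  qed
  ultimately show ?thesis by (intro exI[of _ Q]) (auto simp: Q_def B0_def)
qed

text \<open>The first-moment bound: each further step of a walk multiplies the total weight by at most the
expected number \<open>r\<close> of open neighbours. The count is over all walks in \<open>S\<close>, self-avoiding or not.\<close>

lemma sum_walks_le:
  fixes \<pi> :: "'x \<Rightarrow> real"
  assumes fin: "\<And>x. finite (N x)"
    and pos: "\<And>x. 0 \<le> \<pi> x"
    and r: "\<And>x. x \<in> S \<Longrightarrow> (\<Sum>y\<in>N x \<inter> S. \<pi> y) \<le> r"
    and x: "x \<in> S"
  shows "(\<Sum>xs\<in>walks N S k x. prod_list (map \<pi> xs)) \<le> \<pi> x * r ^ k"
  using x
proof (induction k arbitrary: x)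
  case (Suc k)
  have r0: "0 \<le> r" using r[OF Suc.prems] pos by (meson order_trans sum_nonneg)
  have "(\<Sum>xs\<in>walks N S (Suc k) x. prod_list (map \<pi> xs))
      = (\<Sum>y\<in>N x \<inter> S. \<Sum>xs\<in>(#) x ` walks N S k y. prod_list (map \<pi> xs))"
    unfolding walks.simps
    by (rule sum.UNION_disjoint) (use fin walks_nonempty in \<open>auto simp: finite_walks, fast\<close>)
  also have "\<dots> = \<pi> x * (\<Sum>y\<in>N x \<inter> S. \<Sum>xs\<in>walks N S k y. prod_list (map \<pi> xs))"
    by (simp add: sum.reindex sum_distrib_left)
  also have "\<dots> \<le> \<pi> x * (\<Sum>y\<in>N x \<inter> S. \<pi> y * r ^ k)"
    by (intro mult_left_mono sum_mono Suc.IH pos) auto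
  also have "\<dots> = \<pi> x * (\<Sum>y\<in>N x \<inter> S. \<pi> y) * r ^ k"
    by (simp add: sum_distrib_right mult.assoc)
  also have "\<dots> \<le> \<pi> x * r * r ^ k"
    by (intro mult_right_mono mult_left_mono r Suc.prems pos zero_le_power r0)
  finally show ?case by (simp add: mult.assoc)
qed auto

section \<open>Independent site percolation\<close>

context prob_space
begin

lemma indep_vars_prob_all:
  assumes ind: "indep_vars (\<lambda>_. count_space (UNIV :: bool set)) op X"
    and J: "finite J" "J \<subseteq> X"
  shows "prob {\<omega>\<in>space M. \<forall>x\<in>J. op x \<omega>} = (\<Prod>x\<in>J. prob {\<omega>\<in>space M. op x \<omega>})"
proof (cases "J = {}")
  case False
  have "prob (\<Inter>x\<in>J. op x -` {True} \<inter> space M) = (\<Prod>x\<in>J. prob (op x -` {True} \<inter> space M))"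
    using False J by (intro indep_varsD[OF ind]) auto
  moreover have "op x -` {True} \<inter> space M = {\<omega>\<in>space M. op x \<omega>}" for x by auto
  moreover have "(\<Inter>x\<in>J. {\<omega>\<in>space M. op x \<omega>}) = {\<omega>\<in>space M. \<forall>x\<in>J. op x \<omega>}"
    using False by auto
  ultimately show ?thesis by simp
qed (simp add: prob_space)

text \<open>Events that are determined by the states in pairwise disjoint finite sets of sites are
independent. Finiteness of the blocks makes every such event measurable, however it is described.\<close>

lemma indep_events_disjoint_blocks:
  fixes Q :: "'i \<Rightarrow> 'x set \<Rightarrow> bool"
  assumes ind: "indep_vars (\<lambda>_. count_space (UNIV :: bool set)) op X"
    and J: "\<And>i. i \<in> I \<Longrightarrow> finite (J i)" "\<And>i. i \<in> I \<Longrightarrow> J i \<subseteq> X" "disjoint_family_on J I"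
    and Q: "\<And>i A. i \<in> I \<Longrightarrow> Q i A = Q i (A \<inter> J i)"
  shows "indep_events (\<lambda>i. {\<omega>\<in>space M. Q i {x. op x \<omega>}}) I"
proof -
  have "indep_vars (\<lambda>i. PiM (J i) (\<lambda>_. count_space UNIV)) (\<lambda>i \<omega>. restrict (\<lambda>x. op x \<omega>) (J i)) I"
    by (rule indep_vars_restrict[OF ind J(2,3)])
  then have "indep_vars (\<lambda>_. count_space UNIV)
      (\<lambda>i \<omega>. Q i {x\<in>J i. restrict (\<lambda>x. op x \<omega>) (J i) x}) I"
    by (rule indep_vars_compose2) (simp add: count_space_PiM_finite J)
  also have "?this \<longleftrightarrow> indep_vars (\<lambda>_. count_space UNIV) (\<lambda>i \<omega>. Q i {x. op x \<omega>}) I"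
  proof (rule indep_vars_cong)
    fix i assume i: "i \<in> I"
    have "{x\<in>J i. restrict (\<lambda>x. op x \<omega>) (J i) x} = {x. op x \<omega>} \<inter> J i" for \<omega> by auto
    then show "(\<lambda>\<omega>. Q i {x\<in>J i. restrict (\<lambda>x. op x \<omega>) (J i) x}) = (\<lambda>\<omega>. Q i {x. op x \<omega>})"
      using Q[OF i] by auto
  qed auto
  finally have iv: "indep_vars (\<lambda>_. count_space UNIV) (\<lambda>i \<omega>. Q i {x. op x \<omega>}) I" .
  show ?thesis
  proof (rule indep_eventsI)
    fix i assume "i \<in> I"
    then show "{\<omega>\<in>space M. Q i {x. op x \<omega>}} \<in> events"
      using iv by (intro predE) (simp add: indep_vars_def)
  next
    fix K assume K: "K \<subseteq> I" "finite K" "K \<noteq> {}"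
    have "(\<Inter>i\<in>K. {\<omega>\<in>space M. Q i {x. op x \<omega>}}) = {\<omega>\<in>space M. \<forall>i\<in>K. Q i {x. op x \<omega>}}"
      using K by auto
    then show "prob (\<Inter>i\<in>K. {\<omega>\<in>space M. Q i {x. op x \<omega>}}) =
        (\<Prod>i\<in>K. prob {\<omega>\<in>space M. Q i {x. op x \<omega>}})"
      using indep_vars_prob_all[OF iv K(2,1)] by simp
  qed
qed

text \<open>The limes superior of the events has probability at least \<open>\<delta>\<close>, and by the Borel zero-one
law it has probability 0 or 1.\<close>

lemma AE_infinitely_often:
  fixes P :: "nat \<Rightarrow> 'a \<Rightarrow> bool"
  assumes ind: "indep_events (\<lambda>j. {\<omega>\<in>space M. P j \<omega>}) UNIV"
    and \<delta>: "\<delta> > 0" "\<And>j. prob {\<omega>\<in>space M. P j \<omega>} \<ge> \<delta>"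
  shows "AE \<omega> in M. infinite {j. P j \<omega>}"
proof -
  have [measurable]: "{\<omega>\<in>space M. P j \<omega>} \<in> events" for j
    using ind by (auto simp: indep_events_def)
  define U where "U n = (\<Union>m\<in>{n..}. {\<omega>\<in>space M. P m \<omega>})" for n
  have U [measurable]: "U n \<in> events" for n unfolding U_def by measurable
  have "decseq U" by (force simp: decseq_def U_def)
  then have lim: "(\<lambda>n. prob (U n)) \<longlonglongrightarrow> prob (\<Inter>n. U n)"
    using U by (intro finite_Lim_measure_decseq) auto
  have "\<delta> \<le> prob (U n)" for n
    using \<delta>(2)[of n] finite_measure_mono[of "{\<omega>\<in>space M. P n \<omega>}" "U n"] U by (force simp: U_def)
  then have ge: "\<delta> \<le> prob (\<Inter>n. U n)" by (intro LIMSEQ_le_const[OF lim]) auto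
  have "\<not> (AE \<omega> in M. finite {j. P j \<omega>})"
  proof
    assume fin: "AE \<omega> in M. finite {j. P j \<omega>}"
    have "AE \<omega> in M. \<omega> \<notin> (\<Inter>n. U n)"
      using fin
    proof eventually_elim
      case (elim \<omega>)
      then obtain n where "\<forall>j\<in>{j. P j \<omega>}. j < n" 
        using finite_nat_set_iff_bounded by blast
      then have "\<omega> \<notin> U n" by (force simp: U_def)
      then show ?case by auto
    qed
    then have "prob (\<Inter>n. U n) = 0" by (subst prob_eq_0) (auto intro: sets.countable_INT)
    then show False using ge \<delta> by simp
  qed
  then show ?thesis using borel_0_1_law_AE[OF ind] by auto
qed

lemma prob_reach_le:
  assumes ind: "indep_vars (\<lambda>_. count_space (UNIV :: bool set)) op X"
    and S: "S \<subseteq> X" and fin: "\<And>x. finite (N x)"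
    and r: "\<And>x. x \<in> S \<Longrightarrow> (\<Sum>y\<in>N x \<inter> S. prob {\<omega>\<in>space M. op y \<omega>}) \<le> r"
    and x: "x \<in> S"
  shows "{\<omega>\<in>space M. reach N S {y. op y \<omega>} k x} \<in> events"
    and "prob {\<omega>\<in>space M. reach N S {y. op y \<omega>} k x} \<le> r ^ k"
proof -
  let ?W = "{xs\<in>walks N S k x. distinct xs}"
  let ?E = "\<lambda>xs. {\<omega>\<in>space M. \<forall>y\<in>set xs. op y \<omega>}"
  have finW: "finite ?W" "finite (walks N S k x)" by (auto simp: finite_walks fin)
  have sub: "set xs \<subseteq> X" if "xs \<in> walks N S k x" for xs
    using walks_subset[OF that] x S by auto
  have rv: "op y \<in> measurable M (count_space UNIV)" if "y \<in> X" for y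
    using ind that by (auto simp: indep_vars_def)
  have E: "?E xs \<in> events" if "xs \<in> ?W" for xs
    by (intro predE pred_intros_finite) (use that sub rv in auto)
  have eq: "{\<omega>\<in>space M. reach N S {y. op y \<omega>} k x} = (\<Union>xs\<in>?W. ?E xs)"
    by (auto simp: reach_def)
  show "{\<omega>\<in>space M. reach N S {y. op y \<omega>} k x} \<in> events"
    unfolding eq using E finW by (intro sets.finite_UN) auto
  have "prob (\<Union>xs\<in>?W. ?E xs) \<le> (\<Sum>xs\<in>?W. prob (?E xs))"
    using E finW by (intro finite_measure_subadditive_finite) auto
  also have "\<dots> = (\<Sum>xs\<in>?W. prod_list (map (\<lambda>y. prob {\<omega>\<in>space M. op y \<omega>}) xs))"
    using sub by (intro sum.cong refl)
      (auto simp: indep_vars_prob_all[OF ind] prod.distinct_set_conv_list)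
  also have "\<dots> \<le> (\<Sum>xs\<in>walks N S k x. prod_list (map (\<lambda>y. prob {\<omega>\<in>space M. op y \<omega>}) xs))"
    by (intro sum_mono2 finW prod_list_nonneg) auto
  also have "\<dots> \<le> prob {\<omega>\<in>space M. op x \<omega>} * r ^ k"
    by (intro sum_walks_le fin r x) auto
  also have "\<dots> \<le> r ^ k"
  proof -
    have "0 \<le> r" using r[OF x] by (meson measure_nonneg order_trans sum_nonneg)
    then show ?thesis by (intro mult_left_le_one_le) auto
  qed
  finally show "prob {\<omega>\<in>space M. reach N S {y. op y \<omega>} k x} \<le> r ^ k" unfolding eq .
qed

end

section \<open>The layered graph\<close>

definition depth :: "int \<times> 'e \<Rightarrow> nat" where
  "depth x = nat (- fst x)"

definition nbrs :: "('v, 'e) mgraph \<Rightarrow> int \<times> 'e \<Rightarrow> (int \<times> 'e) set" where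
  "nbrs G x = {y. x \<in> edges (bar G) \<and> y \<in> edges (bar G) \<and> y \<noteq> x \<and>
     \<bar>fst x - fst y\<bar> \<le> 1 \<and> ends G (snd x) \<inter> ends G (snd y) \<noteq> {}}"

lemma edges_bar: "edges (bar G) = {..<0} \<times> edges G"
  by (simp add: bar_def)

text \<open>This is valid for every level \<open>n\<close>, also when \<open>(n, e)\<close> is not an edge of \<open>bar G\<close>, as is required
for the top level \<open>n = -1\<close>.\<close>

lemma meets_bar: "meets (bar G) (n, e) C \<longleftrightarrow> (\<exists>f. (n, f) \<in> C \<and> ends G e \<inter> ends G f \<noteq> {})"
  unfolding meets_def bar_def by force

lemma depth_nbrs: "y \<in> nbrs G x \<Longrightarrow> depth y \<le> depth x + 1 \<and> depth x \<le> depth y + 1"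
  by (auto simp: nbrs_def depth_def)

lemma finite_\<Gamma>:
  assumes "mgraph G" "finite_degree G" "finite H" "H \<subseteq> edges G"
  shows "finite (\<Gamma> G H)"
proof (rule finite_subset)
  show "\<Gamma> G H \<subseteq> (\<Union>f\<in>H. \<Union>x\<in>ends G f. {e\<in>edges G. x \<in> ends G e})"
    by (auto simp: \<Gamma>_def meets_def)
  show "finite (\<Union>f\<in>H. \<Union>x\<in>ends G f. {e\<in>edges G. x \<in> ends G e})"
  proof (intro finite_UN_I assms(3))
    fix f assume "f \<in> H"
    then have f: "card (ends G f) = 2" "ends G f \<subseteq> verts G"
      using assms by (auto simp: mgraph_def)
    then show "finite (ends G f)" by (metis card.infinite zero_neq_numeral)
    fix x assume "x \<in> ends G f"
    then show "finite {e\<in>edges G. x \<in> ends G e}"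
      using f assms by (auto simp: finite_degree_def)
  qed
qed

text \<open>The source of the coefficients 2 and 3 in the definition of \<open>g\<close>: an edge has itself as a neighbour
on the two adjacent levels, and each edge that meets it on three levels.\<close>

lemma nbrs_subset:
  "nbrs G (n, e) \<subseteq> {n - 1, n + 1} \<times> {e} \<union> {n - 1, n, n + 1} \<times> \<Gamma> G {e}"
proof
  fix y assume "y \<in> nbrs G (n, e)"
  then obtain m f where y: "y = (m, f)" "f \<in> edges G" "(m, f) \<noteq> (n, e)" "\<bar>n - m\<bar> \<le> 1"
    "ends G e \<inter> ends G f \<noteq> {}" by (cases y) (auto simp: nbrs_def edges_bar)
  have "m = n - 1 \<or> m = n \<or> m = n + 1" using y(4) by arith
  then show "y \<in> {n - 1, n + 1} \<times> {e} \<union> {n - 1, n, n + 1} \<times> \<Gamma> G {e}"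
    using y by (cases "f = e") (auto simp: \<Gamma>_def meets_def)
qed

lemma finite_nbrs:
  assumes "mgraph G" "finite_degree G"
  shows "finite (nbrs G x)"
proof (cases "x \<in> edges (bar G)")
  case True
  then obtain n e where "x = (n, e)" "e \<in> edges G" by (auto simp: edges_bar)
  then show ?thesis
    using finite_\<Gamma>[OF assms, of "{e}"] by (auto intro!: finite_subset[OF nbrs_subset])
qed (simp add: nbrs_def)

lemma sum_nbrs_le:
  assumes "mgraph G" "finite_degree G" "\<And>e. e \<in> edges G \<Longrightarrow> 0 \<le> p e" "x \<in> edges (bar G)"
  shows "(\<Sum>y\<in>nbrs G x. p (snd y)) \<le> g G p (snd x)"
proof -
  obtain n e where x: "x = (n, e)" "e \<in> edges G" using assms by (auto simp: edges_bar)
  have fin: "finite (\<Gamma> G {e})" using finite_\<Gamma>[OF assms(1,2), of "{e}"] x by auto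
  have nonneg: "0 \<le> p f" if "f = e \<or> f \<in> \<Gamma> G {e}" for f
    using assms x that by (auto simp: \<Gamma>_def)
  have "(\<Sum>y\<in>nbrs G x. p (snd y))
      \<le> (\<Sum>y\<in>{n - 1, n + 1} \<times> {e} \<union> {n - 1, n, n + 1} \<times> \<Gamma> G {e}. p (snd y))"
    unfolding x(1) by (intro sum_mono2 nbrs_subset) (use fin nonneg in auto)
  also have "\<dots> = (\<Sum>y\<in>{n - 1, n + 1} \<times> {e}. p (snd y)) + (\<Sum>y\<in>{n - 1, n, n + 1} \<times> \<Gamma> G {e}. p (snd y))"
    by (intro sum.union_disjoint) (use fin in \<open>auto simp: \<Gamma>_def\<close>)
  also have "(\<Sum>y\<in>{n - 1, n + 1} \<times> {e}. p (snd y)) = (\<Sum>m\<in>{n - 1, n + 1}. \<Sum>f\<in>{e}. p f)"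
    by (simp only: sum.cartesian_product) (simp add: case_prod_unfold)
  also have "(\<Sum>y\<in>{n - 1, n, n + 1} \<times> \<Gamma> G {e}. p (snd y)) = (\<Sum>m\<in>{n - 1, n, n + 1}. \<Sum>f\<in>\<Gamma> G {e}. p f)"
    by (simp only: sum.cartesian_product) (simp add: case_prod_unfold)
  finally show ?thesis by (simp add: x g_def)
qed

text \<open>A finite set containing \<open>F\<close> whose outer neighbours are all white competes in the intersection that
defines the cluster, hence bounds it.\<close>

lemma finite_cluster:
  assumes Q: "finite Q" "Q \<subseteq> edges (bar G)" "F \<subseteq> Q"
    and closed: "\<And>x z. \<lbrakk>x \<in> Q; z \<in> nbrs G x; z \<notin> white G en p u\<rbrakk> \<Longrightarrow> z \<in> Q"
  shows "finite (cluster G en p q u F)"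
proof -
  have "white_boundary G en p u Q"
    unfolding white_boundary_def
  proof clarify
    fix n e
    assume ne: "(n, e) \<in> edges (bar G)" "(n, e) \<notin> Q"
      and "meets (bar G) (n - 1, e) Q \<or> meets (bar G) (n, e) Q \<or> meets (bar G) (n + 1, e) Q"
    then obtain m f where "(m, f) \<in> Q" "\<bar>m - n\<bar> \<le> 1" "ends G f \<inter> ends G e \<noteq> {}"
      unfolding meets_bar by fastforce
    then have "(m, f) \<in> Q" "(n, e) \<in> nbrs G (m, f)" using ne Q by (auto simp: nbrs_def)
    then show "(n, e) \<in> white G en p u" using closed ne by blast
  qed
  moreover have "F \<inter> gray G en p q u \<subseteq> Q" using Q by auto
  ultimately have "gray_cluster G en p u (F \<inter> gray G en p q u) \<subseteq> Q"
    using Q by (intro gray_cluster_least(4)) auto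
  then show ?thesis
    unfolding cluster_def using Q by (meson finite_UnI finite_subset)
qed

section \<open>Barriers\<close>

text \<open>Percolation on \<open>bar G\<close> that is subcritical off the columns over a finite set \<open>\<Lambda>\<close>: outside \<open>\<Lambda>\<close> the
expected number of open neighbours is at most \<open>r < 1\<close>, whereas on the columns themselves \<open>g\<close> may be
large.\<close>

locale column_percolation = prob_space M
  for M :: "'a measure" +
  fixes G :: "('v, 'e) mgraph" and p :: "'e \<Rightarrow> real"
    and op :: "int \<times> 'e \<Rightarrow> 'a \<Rightarrow> bool" and \<Lambda> :: "'e set" and r :: real
  assumes graph: "mgraph G" "finite_degree G"
    and indep: "indep_vars (\<lambda>_. count_space UNIV) op (edges (bar G))"
    and prob_op: "x \<in> edges (bar G) \<Longrightarrow> prob {\<omega>\<in>space M. op x \<omega>} = p (snd x)"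
    and p: "e \<in> edges G \<Longrightarrow> 0 \<le> p e" "e \<in> edges G \<Longrightarrow> p e < 1"
    and \<Lambda>: "finite \<Lambda>" "\<Lambda> \<subseteq> edges G"
    and r: "0 \<le> r" "r < 1" "e \<in> edges G - \<Lambda> \<Longrightarrow> g G p e \<le> r"
begin

abbreviation "N \<equiv> nbrs G"
abbreviation "bd \<equiv> \<Gamma> G \<Lambda>"
abbreviation "core \<equiv> {..<0::int} \<times> \<Lambda>"
abbreviation "outer \<equiv> {..<0::int} \<times> (edges G - \<Lambda>)"

text \<open>The \<open>j\<close>-th barrier has its bottom at depth \<open>4 ^ (j + 1)\<close>. Its window consists of the lowest \<open>K\<close>
levels down to this depth, over \<open>\<Lambda>\<close> and the edges next to \<open>\<Lambda>\<close>.\<close>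

definition bottom :: "nat \<Rightarrow> nat" where
  "bottom j = 4 ^ Suc j"

definition window :: "nat \<Rightarrow> nat \<Rightarrow> (int \<times> 'e) set" where
  "window K j = {- int (bottom j) ..< int K - int (bottom j)} \<times> (\<Lambda> \<union> bd)"

text \<open>An excursion away from the core that starts \<open>k\<close> levels above the bottom needs at least \<open>k\<close> steps to
reach it. Prescribing exactly \<open>k\<close> steps confines the walk to depths between \<open>bottom j - 2 * k\<close> and
\<open>bottom j\<close>. For \<open>k \<le> 4 ^ j\<close> these depths exceed \<open>4 ^ j\<close>, the bottom of the preceding barrier, so
the events for different \<open>j\<close> concern disjoint sets of sites. Walks through the window are left out
in order to make the event independent of the state of the window.\<close>

definition near_crossing :: "nat \<Rightarrow> nat \<Rightarrow> (int \<times> 'e) set \<Rightarrow> bool" where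
  "near_crossing K j A \<longleftrightarrow> (\<exists>k\<in>{K..4 ^ j}. \<exists>f\<in>bd.
     reach N (outer - window K j) A k (- int (bottom j - k), f))"

text \<open>The remaining excursions start at depth at most \<open>3 * 4 ^ j\<close>, hence need at least \<open>4 ^ j\<close> steps,
which is unlikely enough for a summable bound.\<close>

definition far_crossing :: "nat \<Rightarrow> (int \<times> 'e) set \<Rightarrow> bool" where
  "far_crossing j A \<longleftrightarrow> (\<exists>m\<in>{1..3 * 4 ^ j}. \<exists>f\<in>bd. reach N outer A (4 ^ j) (- int m, f))"

lemma finite_bd: "finite bd"
  using finite_\<Gamma> graph \<Lambda> by blast

lemma bd: "bd \<subseteq> edges G - \<Lambda>"
  by (auto simp: \<Gamma>_def)

text \<open>The neighbour \<open>y\<close> of the core at which an excursion starts lies \<open>k\<close> levels above the bottom. It is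
closed if \<open>k < K\<close>, and the two kinds of crossing treat the cases \<open>K \<le> k \<le> 4 ^ j\<close> and \<open>4 ^ j < k\<close>.
The bottom level of the window closes the core itself.\<close>

lemma barrier_finite_closed_set:
  assumes K: "1 \<le> K" and white: "A \<inter> window K j = {}"
    and near: "\<not> near_crossing K j A" and far: "\<not> far_crossing j A"
  shows "\<exists>Q. finite Q \<and> Q \<subseteq> edges (bar G) \<and> {-1} \<times> \<Lambda> \<subseteq> Q \<and> (\<forall>x\<in>Q. \<forall>z\<in>N x \<inter> A. z \<in> Q)"
proof -
  let ?d = "bottom j"
  have d: "?d = 4 * 4 ^ j" by (simp add: bottom_def)
  have "\<exists>Q. finite Q \<and> Q \<subseteq> outer \<union> core \<and> {x\<in>core. depth x < ?d} \<subseteq> Q \<and> 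
      (\<forall>x\<in>Q. \<forall>z\<in>N x \<inter> A. z \<in> Q)"
  proof (rule finite_closed_set)
    show "finite (N x)" for x by (rule finite_nbrs[OF graph])
    show "y \<in> N x \<Longrightarrow> depth y \<le> depth x + 1 \<and> depth x \<le> depth y + 1" for x y
      by (rule depth_nbrs)
    show "N x \<subseteq> outer \<union> core" for x by (auto simp: nbrs_def edges_bar)
    have "{x\<in>core. depth x < ?d} \<subseteq> {- int ?d..<0} \<times> \<Lambda>" by (auto simp: depth_def)
    then show "finite {x\<in>core. depth x < ?d}" using \<Lambda> by (auto elim!: finite_subset)
    show "x \<notin> A" if "x \<in> core" "depth x = ?d" for x
    proof -
      obtain n f where "x = (n, f)" "n < 0" "f \<in> \<Lambda>" using \<open>x \<in> core\<close> by auto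
      moreover have "n = - int ?d" using calculation \<open>depth x = ?d\<close> by (simp add: depth_def)
      ultimately have "x \<in> window K j" using K by (simp add: window_def)
      then show ?thesis using white by auto
    qed
    show "\<exists>k. depth y + k \<le> ?d \<and> \<not> reach N outer A k y"
      if b: "b \<in> core" "depth b < ?d" and y: "y \<in> N b" "y \<in> outer" "y \<in> A" for b y
    proof -
      define k where "k = ?d - depth y"
      have dy: "1 \<le> depth y" "depth y \<le> ?d" "y = (- int (depth y), snd y)"
        using y b depth_nbrs[OF y(1)] by (auto simp: depth_def)
      have f: "snd y \<in> bd" using b y by (fastforce simp: nbrs_def \<Gamma>_def meets_def)
      have k: "depth y = ?d - k" "depth y + k = ?d" using dy by (auto simp: k_def)
      consider "k < K" | "K \<le> k" "k \<le> 4 ^ j" | "4 ^ j < k" by linarith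
      then show ?thesis
      proof cases
        case 1
        then have "(- int (depth y), snd y) \<in> window K j"
          using k f by (auto simp: window_def)
        then show ?thesis using white y dy(3) by auto
      next
        case 2
        then have "\<not> reach N (outer - window K j) A k y"
          using near f k(1) dy(3) by (force simp: near_crossing_def)
        then show ?thesis using reach_restrict[OF _ white] k by (metis order_refl)
      next
        case 3
        then have m: "depth y \<in> {1..3 * 4 ^ j}" "depth y + 4 ^ j \<le> ?d"
          using k d dy by auto
        then have "\<not> reach N outer A (4 ^ j) y"
          using far f dy(3) unfolding far_crossing_def by metis
        then show ?thesis using m by auto
      qed
    qed
  qed
  then obtain Q where Q: "finite Q" "Q \<subseteq> outer \<union> core" "{x\<in>core. depth x < ?d} \<subseteq> Q"
      "\<forall>x\<in>Q. \<forall>z\<in>N x \<inter> A. z \<in> Q" by blast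
  have "(0::nat) < 4 ^ j" by simp
  then have "1 < ?d" unfolding d by linarith
  then have "{-1} \<times> \<Lambda> \<subseteq> {x\<in>core. depth x < ?d}" by (auto simp: depth_def)
  then have "{-1} \<times> \<Lambda> \<subseteq> Q" "Q \<subseteq> edges (bar G)" using Q \<Lambda> by (auto simp: edges_bar)
  with Q show ?thesis by blast
qed

definition crossing_sites :: "nat \<Rightarrow> nat \<Rightarrow> (int \<times> 'e) set" where
  "crossing_sites K j = (\<Union>k\<in>{K..4 ^ j}. \<Union>f\<in>bd. 
     \<Union>xs\<in>walks N (outer - window K j) k (- int (bottom j - k), f). set xs)"

lemma start_near:
  assumes "1 \<le> K" "k \<in> {K..4 ^ j}" "f \<in> bd"
  shows "(- int (bottom j - k), f) \<in> outer - window K j"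
proof -
  have "(0::nat) < 4 ^ j" by simp
  then have "k < bottom j" using assms(2) unfolding bottom_def power_Suc atLeastAtMost_iff by linarith
  then show ?thesis using assms bd by (auto simp: window_def)
qed

lemma crossing_sites_outer: "1 \<le> K \<Longrightarrow> crossing_sites K j \<subseteq> outer - window K j"
  unfolding crossing_sites_def using start_near walks_subset by fast

lemma finite_blocks: "finite (crossing_sites K j)" "finite (window K j)"
  using finite_bd \<Lambda> by (auto simp: crossing_sites_def window_def finite_walks finite_nbrs[OF graph])

lemma near_crossing_depends: "near_crossing K j A \<longleftrightarrow> near_crossing K j (A \<inter> crossing_sites K j)"
  unfolding near_crossing_def reach_def
proof (intro bex_cong refl conj_cong)
  fix k f xs assume "k \<in> {K..4 ^ j}" "f \<in> bd"
    and "xs \<in> walks N (outer - window K j) k (- int (bottom j - k), f)"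
  then have "set xs \<subseteq> crossing_sites K j" unfolding crossing_sites_def by blast
  then show "set xs \<subseteq> A \<longleftrightarrow> set xs \<subseteq> A \<inter> crossing_sites K j" by simp
qed

text \<open>The sites of the \<open>j\<close>-th barrier have depth in the interval from \<open>4 ^ j\<close> (exclusive) to
\<open>4 ^ (j + 1)\<close> (inclusive). These intervals are disjoint, which makes the barriers independent.\<close>

lemma blocks_depth:
  assumes K: "1 \<le> K" "K \<le> 4 ^ j" and x: "x \<in> window K j \<union> crossing_sites K j"
  shows "x \<in> edges (bar G)" "4 ^ j < depth x" "depth x \<le> 4 ^ Suc j"
proof -
  have win: "x \<in> edges (bar G) \<and> 4 ^ j < depth x \<and> depth x \<le> 4 ^ Suc j" if "x \<in> window K j"
  proof -
    obtain n f where x: "x = (n, f)" by (cases x)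
    have nf: "f \<in> \<Lambda> \<union> bd" "- int (bottom j) \<le> n" "n < int K - int (bottom j)"
      using that unfolding window_def x by auto
    have "int K \<le> 4 ^ j" "int (bottom j) = 4 * 4 ^ j" "(0::int) < 4 ^ j" 
      using K by (auto simp: bottom_def)
    then have "n < - 3 * 4 ^ j" "n \<ge> - 4 * 4 ^ j" "(0::int) < 4 ^ j" using nf by linarith+
    then have "n < - (4 ^ j)" "n < 0" "n \<ge> - 4 * 4 ^ j" by linarith+
    then have "n < 0" "int (4 ^ j) < - n" "- n \<le> int (4 ^ Suc j)" by auto
    then show ?thesis using x nf \<Lambda> bd by (auto simp: edges_bar depth_def nat_le_iff zless_nat_eq_int_zless simp del: of_nat_power)
  qed
  have sit: "x \<in> edges (bar G) \<and> 4 ^ j < depth x \<and> depth x \<le> 4 ^ Suc j" if x: "x \<in> crossing_sites K j"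
  proof -
    from x obtain k f xs where k: "k \<le> 4 ^ j"
      and xs: "xs \<in> walks N (outer - window K j) k (- int (bottom j - k), f)" "x \<in> set xs"
      by (auto simp: crossing_sites_def)
    have "depth x \<le> bottom j - k + k \<and> bottom j - k \<le> depth x + k"
      using height_walks[OF _ xs, of depth] depth_nbrs[of _ G]
      by (simp add: depth_def[of "(_, _)"])
    moreover have "(0::nat) < 4 ^ j" by simp
    ultimately have "4 ^ j < depth x" "depth x \<le> 4 ^ Suc j" using k unfolding bottom_def power_Suc by linarith+
    then show ?thesis using crossing_sites_outer[OF K(1)] x by (auto simp: edges_bar)
  qed
  show "x \<in> edges (bar G)" "4 ^ j < depth x" "depth x \<le> 4 ^ Suc j"
    using win sit x by auto
qed

lemma prob_reach_outer:
  assumes "S \<subseteq> outer" "x \<in> S"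
  shows "{\<omega>\<in>space M. reach N S {y. op y \<omega>} k x} \<in> events"
    and "prob {\<omega>\<in>space M. reach N S {y. op y \<omega>} k x} \<le> r ^ k"
proof -
  have S: "S \<subseteq> edges (bar G)" using assms by (auto simp: edges_bar)
  have *: "(\<Sum>y\<in>N z \<inter> S. prob {\<omega>\<in>space M. op y \<omega>}) \<le> r" if "z \<in> S" for z
  proof -
    have "(\<Sum>y\<in>N z \<inter> S. prob {\<omega>\<in>space M. op y \<omega>}) = (\<Sum>y\<in>N z \<inter> S. p (snd y))"
      using S by (intro sum.cong refl prob_op) auto
    also have "\<dots> \<le> (\<Sum>y\<in>N z. p (snd y))"
      using p by (intro sum_mono2 finite_nbrs[OF graph]) (auto simp: nbrs_def edges_bar)
    also have "\<dots> \<le> g G p (snd z)"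
      using that S by (intro sum_nbrs_le graph p) auto
    also have "\<dots> \<le> r" using that assms by (intro r) auto
    finally show ?thesis .
  qed
  show "{\<omega>\<in>space M. reach N S {y. op y \<omega>} k x} \<in> events"
    "prob {\<omega>\<in>space M. reach N S {y. op y \<omega>} k x} \<le> r ^ k"
    using prob_reach_le[OF indep S finite_nbrs[OF graph] * assms(2)] by auto
qed

lemma prob_far_crossing:
  shows "{\<omega>\<in>space M. far_crossing j {y. op y \<omega>}} \<in> events"
    and "prob {\<omega>\<in>space M. far_crossing j {y. op y \<omega>}} \<le> 3 * card bd * (4 ^ j * r ^ 4 ^ j)"
proof -
  let ?E = "\<lambda>x. {\<omega>\<in>space M. reach N outer {y. op y \<omega>} (4 ^ j) x}"
  let ?X = "(\<lambda>m. - int m) ` {1..3 * 4 ^ j} \<times> bd"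
  have eq: "{\<omega>\<in>space M. far_crossing j {y. op y \<omega>}} = (\<Union>x\<in>?X. ?E x)"
    by (auto simp: far_crossing_def)
  have X: "?X \<subseteq> outer" "finite ?X" using bd finite_bd by auto
  have E: "?E x \<in> events" "prob (?E x) \<le> r ^ 4 ^ j" if "x \<in> ?X" for x
    using prob_reach_outer[OF order_refl subsetD[OF X(1) that]] by blast+
  show "{\<omega>\<in>space M. far_crossing j {y. op y \<omega>}} \<in> events"
    unfolding eq using E X by (intro sets.finite_UN) auto
  have "prob (\<Union>x\<in>?X. ?E x) \<le> (\<Sum>x\<in>?X. prob (?E x))"
    using E X by (intro finite_measure_subadditive_finite) auto
  also have "\<dots> \<le> (\<Sum>x\<in>?X. r ^ 4 ^ j)" by (intro sum_mono E)
  also have "\<dots> = 3 * card bd * (4 ^ j * r ^ 4 ^ j)"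
    by (simp add: card_cartesian_product card_image inj_on_def)
  finally show "prob {\<omega>\<in>space M. far_crossing j {y. op y \<omega>}} \<le> 3 * card bd * (4 ^ j * r ^ 4 ^ j)"
    unfolding eq .
qed

lemma prob_near_crossing:
  assumes K: "1 \<le> K"
  shows "{\<omega>\<in>space M. near_crossing K j {y. op y \<omega>}} \<in> events"
    and "prob {\<omega>\<in>space M. near_crossing K j {y. op y \<omega>}} \<le> card bd * (r ^ K / (1 - r))"
proof -
  let ?E = "\<lambda>(k, f). {\<omega>\<in>space M. reach N (outer - window K j) {y. op y \<omega>} k (- int (bottom j - k), f)}"
  let ?X = "{K..4 ^ j} \<times> bd"
  have eq: "{\<omega>\<in>space M. near_crossing K j {y. op y \<omega>}} = (\<Union>x\<in>?X. ?E x)"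
    by (auto simp: near_crossing_def)
  have X: "finite ?X" using finite_bd by auto
  have E: "?E x \<in> events" "prob (?E x) \<le> r ^ fst x" if "x \<in> ?X" for x
    using prob_reach_outer[OF Diff_subset start_near[OF K]] that by auto
  show "{\<omega>\<in>space M. near_crossing K j {y. op y \<omega>}} \<in> events"
    unfolding eq using E X by (intro sets.finite_UN) auto
  have "prob (\<Union>x\<in>?X. ?E x) \<le> (\<Sum>x\<in>?X. prob (?E x))"
    using E X by (intro finite_measure_subadditive_finite) auto
  also have "\<dots> \<le> (\<Sum>x\<in>?X. r ^ fst x)" by (intro sum_mono E)
  also have "\<dots> = (\<Sum>k\<in>{K..4 ^ j}. \<Sum>f\<in>bd. r ^ k)"
    by (simp only: sum.cartesian_product) (simp add: case_prod_unfold)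
  also have "\<dots> = card bd * (\<Sum>k\<in>{K..4 ^ j}. r ^ k)" by (simp add: sum_distrib_left)
  also have "(\<Sum>k\<in>{K..4 ^ j}. r ^ k) \<le> r ^ K / (1 - r)"
    using r by (auto simp: sum_gp divide_right_mono)
  finally show "prob {\<omega>\<in>space M. near_crossing K j {y. op y \<omega>}} \<le> card bd * (r ^ K / (1 - r))"
    unfolding eq by (simp add: mult_left_mono)
qed

lemma prob_window_white:
  assumes K: "1 \<le> K" "K \<le> 4 ^ j"
  shows "prob {\<omega>\<in>space M. {y. op y \<omega>} \<inter> window K j = {}} = (\<Prod>e\<in>\<Lambda> \<union> bd. 1 - p e) ^ K"
proof -
  have sub: "window K j \<subseteq> edges (bar G)" using blocks_depth[OF K] by auto
  have rv: "op x \<in> measurable M (count_space UNIV)" if "x \<in> edges (bar G)" for x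
    using indep that by (auto simp: indep_vars_def)
  have ind: "indep_vars (\<lambda>_. count_space UNIV) (\<lambda>x \<omega>. \<not> op x \<omega>) (edges (bar G))"
    by (rule indep_vars_compose2[OF indep]) auto
  have "{\<omega>\<in>space M. {y. op y \<omega>} \<inter> window K j = {}} = {\<omega>\<in>space M. \<forall>x\<in>window K j. \<not> op x \<omega>}"
    by auto
  then have "prob {\<omega>\<in>space M. {y. op y \<omega>} \<inter> window K j = {}}
      = (\<Prod>x\<in>window K j. prob {\<omega>\<in>space M. \<not> op x \<omega>})"
    using indep_vars_prob_all[OF ind finite_blocks(2) sub] by simp
  also have "\<dots> = (\<Prod>x\<in>window K j. 1 - p (snd x))"
  proof (intro prod.cong refl)
    fix x assume "x \<in> window K j"
    then have x: "x \<in> edges (bar G)" using sub by auto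
    then have "{\<omega>\<in>space M. op x \<omega>} \<in> events" using rv[OF x] by (intro predE)
    then show "prob {\<omega>\<in>space M. \<not> op x \<omega>} = 1 - p (snd x)"
      using prob_neg prob_op[OF x] by simp
  qed
  also have "\<dots> = (\<Prod>n\<in>{- int (bottom j) ..< int K - int (bottom j)}. \<Prod>e\<in>\<Lambda> \<union> bd. 1 - p e)"
    unfolding window_def by (simp only: prod.cartesian_product) (simp add: case_prod_unfold)
  finally show ?thesis by simp
qed

definition barrier :: "nat \<Rightarrow> nat \<Rightarrow> (int \<times> 'e) set \<Rightarrow> bool" where
  "barrier K j A \<longleftrightarrow> A \<inter> window K j = {} \<and> \<not> near_crossing K j A"

text \<open>The lower bound does not depend on \<open>j\<close>: the window contains the same finite number of sites at
every depth, and it is independent of the absence of near crossings, which has probability at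
least one half once \<open>K\<close> is large.\<close>

lemma prob_barrier_ge:
  assumes K: "1 \<le> K" "K \<le> 4 ^ j" and half: "card bd * (r ^ K / (1 - r)) \<le> 1 / 2"
  shows "prob {\<omega>\<in>space M. barrier K j {y. op y \<omega>}} \<ge> (\<Prod>e\<in>\<Lambda> \<union> bd. 1 - p e) ^ K / 2"
proof -
  define Q where "Q b A \<longleftrightarrow> (if b then A \<inter> window K j = {} else \<not> near_crossing K j A)" 
    for b :: bool and A
  define J where "J b = (if b then window K j else crossing_sites K j)" for b :: bool
  have ind: "indep_events (\<lambda>b. {\<omega>\<in>space M. Q b {x. op x \<omega>}}) UNIV"
  proof (rule indep_events_disjoint_blocks[OF indep])
    show "finite (J b)" for b by (simp add: J_def finite_blocks)
    show "J b \<subseteq> edges (bar G)" for b using blocks_depth[OF K] by (auto simp: J_def)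
    show "disjoint_family J"
      using crossing_sites_outer[OF K(1)] by (auto simp: disjoint_family_on_def J_def)
    show "Q b A = Q b (A \<inter> J b)" for b A
      using near_crossing_depends[of K j A] by (auto simp: Q_def J_def)
  qed
  have "prob (\<Inter>b\<in>UNIV. {\<omega>\<in>space M. Q b {x. op x \<omega>}}) = (\<Prod>b\<in>UNIV. prob {\<omega>\<in>space M. Q b {x. op x \<omega>}})"
    using ind[unfolded indep_events_def, THEN conjunct2, rule_format, of UNIV] by simp
  moreover have "(\<Inter>b\<in>UNIV. {\<omega>\<in>space M. Q b {x. op x \<omega>}}) = {\<omega>\<in>space M. barrier K j {y. op y \<omega>}}"
    by (auto simp: Q_def barrier_def UNIV_bool)
  ultimately have eq: "prob {\<omega>\<in>space M. barrier K j {y. op y \<omega>}}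
      = prob {\<omega>\<in>space M. Q True {x. op x \<omega>}} * prob {\<omega>\<in>space M. Q False {x. op x \<omega>}}"
    by (simp add: UNIV_bool)
  have "prob {\<omega>\<in>space M. Q True {x. op x \<omega>}} = (\<Prod>e\<in>\<Lambda> \<union> bd. 1 - p e) ^ K"
    using prob_window_white[OF K] by (simp add: Q_def)
  moreover have "1 / 2 \<le> prob {\<omega>\<in>space M. Q False {x. op x \<omega>}}"
    unfolding Q_def if_False prob_neg[OF prob_near_crossing(1)[OF K(1)]]
    using prob_near_crossing(2)[OF K(1), of j] half by linarith
  then have "prob {\<omega>\<in>space M. Q True {x. op x \<omega>}} * (1 / 2)
      \<le> prob {\<omega>\<in>space M. Q True {x. op x \<omega>}} * prob {\<omega>\<in>space M. Q False {x. op x \<omega>}}"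
    by (rule mult_left_mono) simp
  ultimately show ?thesis unfolding eq by simp
qed

lemma le_four_power: "K \<le> 4 ^ (K + j)" for K j :: nat
proof -
  have "K + j < 4 ^ (K + j)" by (rule power_gt_expt) simp
  then show ?thesis by simp
qed

text \<open>The index is shifted by \<open>K\<close> so that \<open>4 ^ j\<close> is at least \<open>K\<close>, which keeps a window of \<open>K\<close> levels
below the preceding barrier.\<close>

lemma indep_barriers:
  assumes K: "1 \<le> K"
  shows "indep_events (\<lambda>j. {\<omega>\<in>space M. barrier K (K + j) {y. op y \<omega>}}) UNIV"
proof (rule indep_events_disjoint_blocks[OF indep])
  let ?J = "\<lambda>j. window K (K + j) \<union> crossing_sites K (K + j)"
  show "finite (?J j)" for j by (simp add: finite_blocks)
  show "?J j \<subseteq> edges (bar G)" for j using blocks_depth[OF K le_four_power] by auto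
  show "disjoint_family ?J"
    unfolding disjoint_family_on_def
  proof (intro ballI impI)
    have aux: "?J i \<inter> ?J j = {}" if "i < j" for i j
    proof (intro equals0I)
      fix x assume x: "x \<in> ?J i \<inter> ?J j"
      have "(4::nat) ^ (K + j) < depth x" "depth x \<le> 4 ^ Suc (K + i)"
        using blocks_depth[OF K le_four_power] x by blast+
      moreover have "(4::nat) ^ Suc (K + i) \<le> 4 ^ (K + j)"
        using that by (intro power_increasing) auto
      ultimately show False by linarith
    qed
    show "?J i \<inter> ?J j = {}" if "i \<noteq> j" for i j
      using that aux[of i j] aux[of j i] by (cases "i < j") (auto simp: Int_commute)
  qed
  show "barrier K (K + j) A = barrier K (K + j) (A \<inter> ?J j)" for j A
  proof -
    have "A \<inter> ?J j \<inter> crossing_sites K (K + j) = A \<inter> crossing_sites K (K + j)"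
      "A \<inter> ?J j \<inter> window K (K + j) = A \<inter> window K (K + j)" by auto
    then show ?thesis
      using near_crossing_depends[of K "K + j" A] near_crossing_depends[of K "K + j" "A \<inter> ?J j"]
      unfolding barrier_def by simp
  qed
qed

text \<open>The bound on \<open>far_crossing j\<close> is a constant times \<open>n * r ^ n\<close> at \<open>n = 4 ^ j\<close>, a subseries of a
convergent series, so the first Borel-Cantelli lemma applies.\<close>

lemma AE_eventually_no_far_crossing:
  "AE \<omega> in M. eventually (\<lambda>j. \<not> far_crossing j {y. op y \<omega>}) sequentially"
proof -
  have "summable (\<lambda>n. of_nat (Suc n) * r ^ n)"
    using geometric_deriv_sums[of r] r by (auto simp: sums_iff)
  then have "summable (\<lambda>n. of_nat n * r ^ n)"
    by (rule summable_comparison_test') (use r in \<open>auto simp: mult_right_mono\<close>)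
  then have "summable ((\<lambda>n. of_nat n * r ^ n) \<circ> (\<lambda>j. 4 ^ j))"
    by (rule summable_reindex) (use r in \<open>auto simp: inj_on_def\<close>)
  then have "summable (\<lambda>j. 3 * card bd * (4 ^ j * r ^ 4 ^ j))"
    by (intro summable_mult) (simp add: o_def)
  then have "summable (\<lambda>j. prob {\<omega>\<in>space M. far_crossing j {y. op y \<omega>}})"
    by (rule summable_comparison_test') (use prob_far_crossing(2) in auto)
  then have "AE \<omega> in M. eventually (\<lambda>j. \<omega> \<in> space M - {\<omega>\<in>space M. far_crossing j {y. op y \<omega>}}) sequentially"
    by (intro borel_cantelli_AE1 prob_far_crossing) (auto simp: emeasure_eq_measure)
  then show ?thesis by eventually_elim (auto elim: eventually_mono)
qed

lemma AE_finite_closed_set: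
  "AE \<omega> in M. \<exists>Q. finite Q \<and> Q \<subseteq> edges (bar G) \<and> {-1} \<times> \<Lambda> \<subseteq> Q \<and> 
     (\<forall>x\<in>Q. \<forall>z\<in>N x. op z \<omega> \<longrightarrow> z \<in> Q)"
proof -
  have "(\<lambda>k. card bd * (r ^ k / (1 - r))) \<longlonglongrightarrow> card bd * (0 / (1 - r))"
    using r by (intro tendsto_intros LIMSEQ_power_zero) auto
  then have "eventually (\<lambda>k. card bd * (r ^ k / (1 - r)) < 1 / 2) sequentially"
    by (rule order_tendstoD) simp
  then have "eventually (\<lambda>k. 1 \<le> k \<and> card bd * (r ^ k / (1 - r)) < 1 / 2) sequentially"
    using eventually_ge_at_top[of 1] by eventually_elim auto
  then obtain K where K: "1 \<le> K" "card bd * (r ^ K / (1 - r)) \<le> 1 / 2"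
    by (auto simp: eventually_sequentially less_imp_le)
  have "AE \<omega> in M. infinite {j. barrier K (K + j) {y. op y \<omega>}}"
  proof (rule AE_infinitely_often[OF indep_barriers[OF K(1)]])
    show "(\<Prod>e\<in>\<Lambda> \<union> bd. 1 - p e) ^ K / 2 > 0"
      using p \<Lambda> bd by (intro divide_pos_pos zero_less_power prod_pos) auto
    show "(\<Prod>e\<in>\<Lambda> \<union> bd. 1 - p e) ^ K / 2 \<le> prob {\<omega>\<in>space M. barrier K (K + j) {y. op y \<omega>}}" for j
      by (rule prob_barrier_ge[OF K(1) le_four_power K(2)])
  qed
  with AE_eventually_no_far_crossing show ?thesis
  proof eventually_elim
    case (elim \<omega>)
    then obtain j0 where j0: "\<And>j. j \<ge> j0 \<Longrightarrow> \<not> far_crossing j {y. op y \<omega>}"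
      by (auto simp: eventually_sequentially)
    obtain j where j: "j \<ge> j0" "barrier K (K + j) {y. op y \<omega>}"
      using elim(2) unfolding infinite_nat_iff_unbounded_le by auto
    then show ?case
      using barrier_finite_closed_set[OF K(1), of "{y. op y \<omega>}" "K + j"] j0[of "K + j"]
      by (auto simp: barrier_def)
  qed
qed

end

section \<open>The uniform coordinates\<close>

text \<open>An edge is called open here if its coordinate lies below \<open>p\<close>, that is, if it is black or gray.
Each edge of \<open>bar G\<close> reads a coordinate of its own, so independence is inherited from the product
measure.\<close>

lemma \<U>_open_edges:
  assumes "enumeration en (edges G)" and p: "\<And>e. e \<in> edges G \<Longrightarrow> 0 \<le> p e \<and> p e \<le> 1"
  defines "op \<equiv> \<lambda>x u. u (fst x, inv_into (indices (edges G)) en (snd x)) < p (snd x)"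
  shows "prob_space \<U>"
    and "prob_space.indep_vars \<U> (\<lambda>_. count_space UNIV) op (edges (bar G))"
    and "\<And>x. x \<in> edges (bar G) \<Longrightarrow> measure \<U> {u\<in>space \<U>. op x u} = p (snd x)"
proof -
  let ?I = "restrict_space lborel {0..1::real}"
  let ?idx = "\<lambda>x. (fst x, inv_into (indices (edges G)) en (snd x))"
  have I: "prob_space ?I"
    by (intro prob_space_restrict_space) auto
  show U: "prob_space \<U>" unfolding \<U>_def by (intro prob_space_PiM I)
  interpret U: prob_space \<U> by (rule U)
  have bij: "bij_betw en (indices (edges G)) (edges G)" using assms by (simp add: enumeration_def)
  have idx: "?idx x \<in> \<A>" if "x \<in> edges (bar G)" for x
  proof -
    have "inv_into (indices (edges G)) en (snd x) \<in> indices (edges G)"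
      using that bij by (intro inv_into_into) (auto simp: edges_bar bij_betw_def)
    then show ?thesis using that by (auto simp: \<A>_def indices_def edges_bar)
  qed
  have inj: "inj_on ?idx (edges (bar G))"
    using bij by (auto simp: inj_on_def edges_bar bij_betw_def inv_into_injective dest: inv_into_injective)
  have coord: "U.indep_vars (\<lambda>_. ?I) (\<lambda>i u. u i) \<A>"
  proof (cases "\<A> = {}")
    case False
    have rv: "(\<lambda>u. u i) \<in> \<U> \<rightarrow>\<^sub>M ?I" if "i \<in> \<A>" for i
      unfolding \<U>_def using that by measurable
    have "distr \<U> (PiM \<A> (\<lambda>_. ?I)) (\<lambda>u. restrict u \<A>) = distr \<U> \<U> (\<lambda>u. u)"
      by (intro distr_cong) (auto simp: \<U>_def space_PiM)
    also have "\<dots> = PiM \<A> (\<lambda>_. ?I)" by (simp add: \<U>_def distr_id2)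
    also have "\<dots> = PiM \<A> (\<lambda>i. distr \<U> ?I (\<lambda>u. u i))"
      unfolding \<U>_def by (intro PiM_cong refl distr_PiM_component[symmetric] I)
    finally show ?thesis by (subst U.indep_vars_iff_distr_eq_PiM'[OF False rv]) auto
  qed (auto simp: \<A>_def)
  \<comment> \<open>Coordinates are passed from pairs of integers to edges by treating each one as a block of its own.\<close>
  have "U.indep_vars (\<lambda>x. PiM {?idx x} (\<lambda>_. ?I)) (\<lambda>x u. restrict (\<lambda>i. u i) {?idx x}) (edges (bar G))"
    by (rule U.indep_vars_restrict[OF coord]) (use idx inj in \<open>auto simp: disjoint_family_on_def inj_on_def\<close>)
  then have "U.indep_vars (\<lambda>_. count_space UNIV)
      (\<lambda>x u. restrict (\<lambda>i. u i) {?idx x} (?idx x) < p (snd x)) (edges (bar G))"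
  proof (rule U.indep_vars_compose2)
    fix x
    have [measurable]: "(\<lambda>f. f (?idx x)) \<in> measurable (PiM {?idx x} (\<lambda>_. ?I)) borel"
      by (rule measurable_compose[OF measurable_component_singleton])
        (auto intro!: measurable_restrict_space1)
    show "(\<lambda>f. f (?idx x) < p (snd x)) \<in> PiM {?idx x} (\<lambda>_. ?I) \<rightarrow>\<^sub>M count_space UNIV"
      by measurable
  qed
  then show "U.indep_vars (\<lambda>_. count_space UNIV) op (edges (bar G))" by (simp add: op_def)
  fix x assume x: "x \<in> edges (bar G)"
  have px: "0 \<le> p (snd x)" "p (snd x) \<le> 1" using p x by (auto simp: edges_bar)
  have "{0..1} \<inter> {..<p (snd x)} \<in> sets ?I"
    by (simp add: sets_restrict_space)
  also have "{0..1} \<inter> {..<p (snd x)} = {y\<in>space ?I. y < p (snd x)}"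
    by (auto simp: space_restrict_space)
  finally have below: "{y\<in>space ?I. y < p (snd x)} \<in> sets ?I" .
  have "measure \<U> {u\<in>space \<U>. op x u} = measure \<U> ((\<lambda>u. u (?idx x)) -` {y\<in>space ?I. y < p (snd x)} \<inter> space \<U>)"
    using idx[OF x] by (intro arg_cong[where f="measure \<U>"]) (auto simp: op_def \<U>_def space_PiM)
  also have "\<dots> = measure (distr \<U> ?I (\<lambda>u. u (?idx x))) {y\<in>space ?I. y < p (snd x)}"
    using idx[OF x] by (intro measure_distr[symmetric] below) (simp add: \<U>_def)
  also have "\<dots> = measure ?I {y\<in>space ?I. y < p (snd x)}"
    unfolding \<U>_def using distr_PiM_component[of \<A> "\<lambda>_. ?I", OF I idx[OF x]] by simp
  also have "\<dots> = measure lborel {0..<p (snd x)}"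
  proof -
    have "{y\<in>space ?I. y < p (snd x)} = {0..<p (snd x)}" using px by (auto simp: space_restrict_space)
    moreover have "measure ?I {0..<p (snd x)} = measure lborel {0..<p (snd x)}"
      by (rule measure_restrict_space) (use px in auto)
    ultimately show ?thesis by simp
  qed
  also have "\<dots> = p (snd x)" using px by simp
  finally show "measure \<U> {u\<in>space \<U>. op x u} = p (snd x)" .
qed

text \<open>The starting edge is added to the finite set \<open>\<Lambda>\<close> on whose complement \<open>g\<close> stays below a constant
\<open>r' < 1\<close>; then the starting edge is a site of the core at depth 1 and lies in the finite closed set.\<close>

theorem theorem8:
  fixes G :: "('v, 'e) mgraph" and p :: "'e \<Rightarrow> real" and q :: real
    and en :: "nat \<Rightarrow> 'e" and L :: ereal
  assumes "countable_graph G" and "finite_degree G"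
    and "\<forall>e\<in>edges G. p e \<in> {0..1}" and "q \<ge> 1"
    and "enumeration en (edges G)"
    and "\<forall>e\<in>edges G. p e < 1"
    and "((\<lambda>\<Lambda>. SUP e\<in>edges G - \<Lambda>. ereal (g G p e)) \<longlongrightarrow> L) (finite_subsets_at_top (edges G))"
    and "L < 1"
  shows "\<forall>e\<in>edges G. AE u in \<U>. finite (cluster G en p q u {(-1, e)})"
proof
  fix e assume e: "e \<in> edges G"
  obtain c where c: "L < c" "c < 1" using dense[OF \<open>L < 1\<close>] by auto
  \<comment> \<open>The limit is \<open>-\<infinity>\<close> if \<open>G\<close> has finitely many edges, but the bound has to be a nonnegative real.\<close>
  have "max c 0 < 1" using c by simp
  from ereal_dense2[OF this] obtain r' where "max c 0 < ereal r'" "ereal r' < 1" by blast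
  then have "0 < r'" "r' < 1" "c < ereal r'" by simp_all
  then have r': "0 \<le> r'" "r' < 1" "c \<le> ereal r'" by simp_all
  have "eventually (\<lambda>\<Lambda>. (SUP e\<in>edges G - \<Lambda>. ereal (g G p e)) < c) (finite_subsets_at_top (edges G))"
    using assms(7) c(1) by (rule order_tendstoD)
  then obtain \<Lambda>0 where \<Lambda>0: "finite \<Lambda>0" "\<Lambda>0 \<subseteq> edges G"
    and sup: "\<forall>\<Lambda>. finite \<Lambda> \<and> \<Lambda>0 \<subseteq> \<Lambda> \<and> \<Lambda> \<subseteq> edges G \<longrightarrow> (SUP e\<in>edges G - \<Lambda>. ereal (g G p e)) < c"
    unfolding eventually_finite_subsets_at_top by (elim exE conjE) (rule that)
  define \<Lambda> where "\<Lambda> = insert e \<Lambda>0"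
  have g: "g G p f \<le> r'" if "f \<in> edges G - \<Lambda>" for f
  proof -
    have "ereal (g G p f) \<le> (SUP e\<in>edges G - \<Lambda>. ereal (g G p e))" using that by (rule SUP_upper)
    also have "\<dots> \<le> c" using e \<Lambda>0 by (intro less_imp_le sup[rule_format]) (auto simp: \<Lambda>_def)
    also have "\<dots> \<le> ereal r'" by fact
    finally show ?thesis by simp
  qed
  let ?op = "\<lambda>x u. u (fst x, inv_into (indices (edges G)) en (snd x)) < p (snd x)"
  have p: "\<And>e. e \<in> edges G \<Longrightarrow> 0 \<le> p e \<and> p e \<le> 1" using assms(3) by auto
  interpret U: prob_space \<U> by (rule \<U>_open_edges(1)[OF assms(5) p])
  interpret column_percolation \<U> G p ?op \<Lambda> r'
  proof
    show "mgraph G" using assms(1) by (simp add: countable_graph_def)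
    show "U.indep_vars (\<lambda>_. count_space UNIV) ?op (edges (bar G))"
      by (rule \<U>_open_edges(2)[OF assms(5) p])
    show "U.prob {u\<in>space \<U>. ?op x u} = p (snd x)" if "x \<in> edges (bar G)" for x
      by (rule \<U>_open_edges(3)[OF assms(5) p that])
  qed (use assms r' g e \<Lambda>0 in \<open>auto simp: \<Lambda>_def\<close>)
  show "AE u in \<U>. finite (cluster G en p q u {(-1, e)})"
    using AE_finite_closed_set AE_space
  proof eventually_elim
    case (elim u)
    then obtain Q where Q: "finite Q" "Q \<subseteq> edges (bar G)" "{-1} \<times> \<Lambda> \<subseteq> Q"
      and closed: "\<And>x z. \<lbrakk>x \<in> Q; z \<in> nbrs G x; ?op z u\<rbrakk> \<Longrightarrow> z \<in> Q" by metis
    show ?case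
    proof (rule finite_cluster[OF Q(1,2)])
      show "{(-1, e)} \<subseteq> Q" using Q(3) by (auto simp: \<Lambda>_def)
      fix x z assume x: "x \<in> Q" "z \<in> nbrs G x" and nw: "z \<notin> white G en p u"
      obtain n f where z: "z = (n, f)" "n < 0" "f \<in> edges G"
        using x by (auto simp: nbrs_def edges_bar)
      let ?k = "inv_into (indices (edges G)) en f"
      have k: "?k \<in> indices (edges G)" "en ?k = f"
        using z assms(5) by (auto simp: enumeration_def bij_betw_def inv_into_into f_inv_into_f)
      then have A: "(n, ?k) \<in> \<A>" using z by (auto simp: \<A>_def indices_def)
      then have "u (n, ?k) \<le> 1" using elim by (auto simp: \<U>_def space_PiM PiE_iff space_restrict_space)
      then have "?op z u" using nw A k z unfolding white_def by force
      then show "z \<in> Q" using closed x by blast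
    qed
  qed
qed

end
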